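(* Let $G$ be a non-discrete metric Weil complete group. Then for every function $f:\mathbb N\to\mathbb N\setminus\{0\}$ the group $G$ contains an unconditionally $f$-productive sequence.
   Context: All topological groups are Hausdorff; $\mathbb N=\{0,1,2,\dots\}$. A metric group is a metrizable topological group. A topological group is Weil complete if it is complete with respect to its left uniformity (a sequence $\{x_n\}$ is left Cauchy if for every neighbourhood $U$ of the identity there is $k$ with $x_l^{-1}x_m\in U$ for all $l,m\ge k$, and likewise for nets; Weil completeness means that all left Cauchy nets converge). Products are ordered: $\prod_{n=0}^m b_n=b_0b_1\cdots b_m$. A sequence $\{b_n:n\in\mathbb N\}$ in a topological group $G$ is productive if $\{\prod_{n=0}^m b_n:m\in\mathbb N\}$ converges to some element of $G$. For $f:\mathbb N\to\mathbb N\setminus\{0\}$, a sequence $\{a_n:n\in\mathbb N\}$ of elements of $G$ is $f$-productive if it is faithfully indexed ($a_n\ne a_m$ for $n\neq m$) and $\{a_n^{z(n)}:n\in\mathbb N\}$ is productive in $G$ for every $z:\mathbb N\to\mathbb Z$ with $|z(n)|\le f(n)$ for all $n\in\mathbb N$. It is unconditionally $f$-productive if it is faithfully indexed and $\{a_{\varphi(n)}:n\in\mathbb N\}$ is $(f\circ\varphi)$-productive for every bijection $\varphi:\mathbb N\to\mathbb N$. *)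

theory Defs
  imports "HOL-Analysis.Analysis" "HOL-Algebra.Group"
begin

locale topological_group = group G for G (structure) +
  fixes T :: "'a topology"
  assumes topspace_eq: "topspace T = carrier G"
    and continuous_mult:
      "continuous_map (prod_topology T T) T (\<lambda>p. fst p \<otimes>\<^bsub>G\<^esub> snd p)"
    and continuous_inv: "continuous_map T T (\<lambda>x. inv\<^bsub>G\<^esub> x)"
    and Hausdorff: "Hausdorff_space T"

definition directed_set :: "'i set \<Rightarrow> 'i rel \<Rightarrow> bool" where
  "directed_set D r \<longleftrightarrow> D \<noteq> {} \<and> preorder_on D r \<and>
     (\<forall>i\<in>D. \<forall>j\<in>D. \<exists>k\<in>D. (i, k) \<in> r \<and> (j, k) \<in> r)"

definition net_converges_to ::
    "'a topology \<Rightarrow> 'i set \<Rightarrow> 'i rel \<Rightarrow> ('i \<Rightarrow> 'a) \<Rightarrow> 'a \<Rightarrow> bool" where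
  "net_converges_to T D r x l \<longleftrightarrow> l \<in> topspace T \<and>
     (\<forall>U. openin T U \<and> l \<in> U \<longrightarrow> (\<exists>k\<in>D. \<forall>i\<in>D. (k, i) \<in> r \<longrightarrow> x i \<in> U))"

definition left_cauchy_net ::
    "('a, 'b) monoid_scheme \<Rightarrow> 'a topology \<Rightarrow> 'i set \<Rightarrow> 'i rel \<Rightarrow> ('i \<Rightarrow> 'a) \<Rightarrow> bool" where
  "left_cauchy_net G T D r x \<longleftrightarrow> x ` D \<subseteq> carrier G \<and>
     (\<forall>U. openin T U \<and> \<one>\<^bsub>G\<^esub> \<in> U \<longrightarrow>
       (\<exists>k\<in>D. \<forall>i\<in>D. \<forall>j\<in>D. (k, i) \<in> r \<and> (k, j) \<in> r
          \<longrightarrow> inv\<^bsub>G\<^esub> (x i) \<otimes>\<^bsub>G\<^esub> x j \<in> U))"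

text \<open>A definition cannot quantify over the index type of a net. Directed sets whose elements are
  subsets of the group suffice: by \<open>weil_complete_net\<close> below, left Cauchy nets over
  arbitrary directed sets then converge as well.\<close>

definition weil_complete :: "('a, 'b) monoid_scheme \<Rightarrow> 'a topology \<Rightarrow> bool" where
  "weil_complete G T \<longleftrightarrow>
     (\<forall>(D :: 'a set set) r x. directed_set D r \<and> left_cauchy_net G T D r x
        \<longrightarrow> (\<exists>l. net_converges_to T D r x l))"

lemma weil_complete_net:
  fixes x :: "'i \<Rightarrow> 'a" and T :: "'a topology"
  assumes "topological_group G T" and complete: "weil_complete G T"
    and dir: "directed_set D r" and cauchy: "left_cauchy_net G T D r x"
  shows "\<exists>l. net_converges_to T D r x l"
proof -
  interpret topological_group G T by fact
  define t where "t d = x ` {e \<in> D. (d, e) \<in> r}" for d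
  define r' where "r' = {(A, B). A \<in> t ` D \<and> B \<in> t ` D \<and> B \<subseteq> A}"
  define y where "y A = (SOME a. a \<in> A)" for A :: "'a set"
  have refl: "(d, d) \<in> r" if "d \<in> D" for d
    using dir that by (auto simp: directed_set_def preorder_on_def refl_on_def)
  have trans: "(a, c) \<in> r" if "(a, b) \<in> r" "(b, c) \<in> r" for a b c
    using dir that by (auto simp: directed_set_def preorder_on_def dest: transD)
  have up: "\<exists>k\<in>D. (i, k) \<in> r \<and> (j, k) \<in> r" if "i \<in> D" "j \<in> D" for i j
    using dir that by (auto simp: directed_set_def)
  have mono: "t e \<subseteq> t d" if "(d, e) \<in> r" for d e
    using that trans by (auto simp: t_def)
  have ytail: "\<exists>e\<in>D. (d, e) \<in> r \<and> y (t d) = x e" if "d \<in> D" for d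
  proof -
    have "x d \<in> t d" using that refl by (auto simp: t_def)
    hence "y (t d) \<in> t d" unfolding y_def by (rule someI)
    thus ?thesis by (auto simp: t_def)
  qed
  have xG: "x d \<in> carrier G" if "d \<in> D" for d
    using cauchy that by (auto simp: left_cauchy_net_def)
  have cauchyD: "\<exists>k\<in>D. \<forall>i\<in>D. \<forall>j\<in>D. (k, i) \<in> r \<and> (k, j) \<in> r
      \<longrightarrow> inv\<^bsub>G\<^esub> (x i) \<otimes>\<^bsub>G\<^esub> x j \<in> U" if "openin T U" "\<one>\<^bsub>G\<^esub> \<in> U" for U
    using cauchy[unfolded left_cauchy_net_def, THEN conjunct2, rule_format, of U] that by simp
  have dir': "directed_set (t ` D) r'"
  proof -
    have "preorder_on (t ` D) r'"
      by (auto simp: r'_def preorder_on_def refl_on_def trans_def)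
    moreover have "\<exists>k\<in>t ` D. (i, k) \<in> r' \<and> (j, k) \<in> r'" if "i \<in> t ` D" "j \<in> t ` D" for i j
    proof -
      from that obtain a b where ab: "a \<in> D" "b \<in> D" "i = t a" "j = t b" by auto
      from up[OF ab(1,2)] obtain c where "c \<in> D" "(a, c) \<in> r" "(b, c) \<in> r" by auto
      thus ?thesis using mono ab by (auto simp: r'_def)
    qed
    moreover have "t ` D \<noteq> {}" using dir by (auto simp: directed_set_def)
    ultimately show ?thesis unfolding directed_set_def by blast
  qed
  have "left_cauchy_net G T (t ` D) r' y"
    unfolding left_cauchy_net_def
  proof (intro conjI allI impI)
    show "y ` t ` D \<subseteq> carrier G" using ytail xG by fastforce
    fix U assume U: "openin T U \<and> \<one>\<^bsub>G\<^esub> \<in> U"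
    obtain k where k: "k \<in> D" "\<forall>i\<in>D. \<forall>j\<in>D. (k, i) \<in> r \<and> (k, j) \<in> r
        \<longrightarrow> inv\<^bsub>G\<^esub> (x i) \<otimes>\<^bsub>G\<^esub> x j \<in> U"
      using cauchyD[OF conjunct1[OF U] conjunct2[OF U]] by (elim bexE)
    have "\<exists>e\<in>D. (k, e) \<in> r \<and> y A = x e" if "A \<in> t ` D" "(t k, A) \<in> r'" for A
    proof -
      from that obtain d where d: "d \<in> D" "A = t d" by auto
      obtain e where "e \<in> D" "(d, e) \<in> r" "y A = x e" using ytail[OF d(1)] d by auto
      hence "y A \<in> t k" using that d by (auto simp: r'_def t_def)
      thus ?thesis by (auto simp: t_def)
    qed
    hence "inv\<^bsub>G\<^esub> (y A) \<otimes>\<^bsub>G\<^esub> y B \<in> U"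
      if "A \<in> t ` D" "B \<in> t ` D" "(t k, A) \<in> r'" "(t k, B) \<in> r'" for A B
      using k(2) that by metis
    moreover have "t k \<in> t ` D" using k(1) by (rule imageI)
    ultimately show "\<exists>K\<in>t ` D. \<forall>i\<in>t ` D. \<forall>j\<in>t ` D. (K, i) \<in> r' \<and> (K, j) \<in> r'
        \<longrightarrow> inv\<^bsub>G\<^esub> (y i) \<otimes>\<^bsub>G\<^esub> y j \<in> U"
      by blast
  qed
  with complete dir' obtain l where l: "net_converges_to T (t ` D) r' y l"
    unfolding weil_complete_def by blast
  have lG: "l \<in> carrier G" using l topspace_eq by (auto simp: net_converges_to_def)
  have "net_converges_to T D r x l"
    unfolding net_converges_to_def
  proof (intro conjI allI impI)
    show "l \<in> topspace T" using lG topspace_eq by simp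
    fix U assume U: "openin T U \<and> l \<in> U"
    let ?P = "{p \<in> topspace (prod_topology T T). fst p \<otimes>\<^bsub>G\<^esub> snd p \<in> U}"
    have "openin (prod_topology T T) ?P"
      using continuous_mult U by (auto simp: continuous_map_def)
    moreover have "(l, \<one>\<^bsub>G\<^esub>) \<in> ?P" using lG U topspace_eq by auto
    ultimately obtain W V where WV: "openin T W" "openin T V" "l \<in> W" "\<one>\<^bsub>G\<^esub> \<in> V" "W \<times> V \<subseteq> ?P"
      unfolding openin_prod_topology_alt by meson
    have "\<exists>K\<in>t ` D. \<forall>A\<in>t ` D. (K, A) \<in> r' \<longrightarrow> y A \<in> W"
      using l[unfolded net_converges_to_def, THEN conjunct2, rule_format, of W] WV(1,3) by simp
    then obtain a where a: "a \<in> D" "\<forall>A\<in>t ` D. (t a, A) \<in> r' \<longrightarrow> y A \<in> W"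
      by blast
    obtain b where b: "b \<in> D" "\<forall>i\<in>D. \<forall>j\<in>D. (b, i) \<in> r \<and> (b, j) \<in> r
        \<longrightarrow> inv\<^bsub>G\<^esub> (x i) \<otimes>\<^bsub>G\<^esub> x j \<in> V"
      using cauchyD[OF WV(2,4)] by (elim bexE)
    obtain c where c: "c \<in> D" "(a, c) \<in> r" "(b, c) \<in> r" using up a b by blast
    obtain e where e: "e \<in> D" "(c, e) \<in> r" "y (t c) = x e" using ytail c by blast
    have "(t a, t c) \<in> r'" using mono a c by (auto simp: r'_def)
    hence xe: "x e \<in> W" using a c e by (metis imageI)
    have "x g \<in> U" if g: "g \<in> D" "(c, g) \<in> r" for g
    proof -
      have "inv\<^bsub>G\<^esub> (x e) \<otimes>\<^bsub>G\<^esub> x g \<in> V" using b(2) e(1) g(1) trans[OF c(3) e(2)] trans[OF c(3) g(2)] by blast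
      hence "x e \<otimes>\<^bsub>G\<^esub> (inv\<^bsub>G\<^esub> (x e) \<otimes>\<^bsub>G\<^esub> x g) \<in> U" using xe WV(5) by auto
      thus ?thesis using xG[OF e(1)] xG[OF g(1)] by (simp add: m_assoc[symmetric])
    qed
    thus "\<exists>k\<in>D. \<forall>i\<in>D. (k, i) \<in> r \<longrightarrow> x i \<in> U" using c by blast
  qed
  thus ?thesis by blast
qed

primrec ordered_prod :: "('a, 'b) monoid_scheme \<Rightarrow> (nat \<Rightarrow> 'a) \<Rightarrow> nat \<Rightarrow> 'a" where
  "ordered_prod G b 0 = b 0"
| "ordered_prod G b (Suc m) = ordered_prod G b m \<otimes>\<^bsub>G\<^esub> b (Suc m)"

definition productive :: "('a, 'b) monoid_scheme \<Rightarrow> 'a topology \<Rightarrow> (nat \<Rightarrow> 'a) \<Rightarrow> bool" where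
  "productive G T b \<longleftrightarrow> range b \<subseteq> carrier G \<and>
     (\<exists>l\<in>carrier G. limitin T (\<lambda>m. ordered_prod G b m) l sequentially)"

definition f_productive ::
    "('a, 'b) monoid_scheme \<Rightarrow> 'a topology \<Rightarrow> (nat \<Rightarrow> nat) \<Rightarrow> (nat \<Rightarrow> 'a) \<Rightarrow> bool" where
  "f_productive G T f a \<longleftrightarrow> range a \<subseteq> carrier G \<and> inj a \<and>
     (\<forall>z :: nat \<Rightarrow> int. (\<forall>n. \<bar>z n\<bar> \<le> int (f n))
        \<longrightarrow> productive G T (\<lambda>n. a n [^]\<^bsub>G\<^esub> z n))"

definition unconditionally_f_productive ::
    "('a, 'b) monoid_scheme \<Rightarrow> 'a topology \<Rightarrow> (nat \<Rightarrow> nat) \<Rightarrow> (nat \<Rightarrow> 'a) \<Rightarrow> bool" where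
  "unconditionally_f_productive G T f a \<longleftrightarrow> range a \<subseteq> carrier G \<and> inj a \<and>
     (\<forall>\<phi> :: nat \<Rightarrow> nat. bij \<phi> \<longrightarrow> f_productive G T (f \<circ> \<phi>) (\<lambda>n. a (\<phi> n)))"

end

theory Submission
  imports Defs
begin

text \<open>Choose a neighbourhood base \<open>U\<^sub>n\<close> of the identity with
  \<open>U\<^sub>n\<^sub>+\<^sub>1 U\<^sub>n\<^sub>+\<^sub>1 U\<^sub>n\<^sub>+\<^sub>1 \<subseteq> U\<^sub>n\<close>. A product of elements of \<open>U\<^sub>i\<close>, with distinct indices
  \<open>i > k\<close> in any order, lies in \<open>U\<^sub>k\<close>: split it at the factor with the smallest index
  and use induction on both sides. Since the group is not discrete, there are distinct
  \<open>a\<^sub>n\<close> whose powers with exponents up to \<open>f n\<close> stay in \<open>U\<^sub>n\<close>; for every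
  rearrangement the partial products then form a left Cauchy sequence.\<close>

section \<open>Injective selection from infinite sets\<close>

text \<open>At stage \<open>n\<close> only the finitely many earlier values are forbidden, and these
  cannot exhaust the infinite set \<open>W n\<close>.\<close>

lemma inj_choice_infinite:
  fixes W :: "nat \<Rightarrow> 'a set"
  assumes "\<And>n. infinite (W n)"
  obtains a where "inj a" "\<And>n. a n \<in> W n"
proof -
  have "\<exists>a. \<forall>n. a n \<in> W n - a ` {..<n}"
  \<comment> \<open>The choice at \<open>n\<close> may depend on all earlier values; the first goal
    checks that the condition looks at nothing else.\<close>
  proof (rule dependent_wellorder_choice)
    fix r :: 'a and g h :: "nat \<Rightarrow> 'a" and n
    assume "\<And>m. m < n \<Longrightarrow> g m = h m"
    then have "g ` {..<n} = h ` {..<n}" by (intro image_cong) auto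
    then show "(r \<in> W n - g ` {..<n}) = (r \<in> W n - h ` {..<n})" by simp
  next
    fix n and g :: "nat \<Rightarrow> 'a"
    have "infinite (W n - g ` {..<n})" using assms by simp
    then show "\<exists>r. r \<in> W n - g ` {..<n}" by (metis finite.emptyI ex_in_conv)
  qed
  then obtain a where a: "\<And>n. a n \<in> W n - a ` {..<n}" by blast
  have "inj a"
  proof (rule linorder_injI)
    fix m n :: nat assume "m < n"
    then have "a m \<in> a ` {..<n}" by simp
    with a[of n] show "a m \<noteq> a n" by (metis DiffD2)
  qed
  then show thesis using that a by blast
qed

section \<open>Products over lists of group elements\<close>

context group
begin

text \<open>\<open>ordered_prod\<close> starts at index 0 and is never empty; lists give arbitrary
  blocks of factors and the empty product, so a product can be split at any factor.\<close>

abbreviation list_prod :: "'a list \<Rightarrow> 'a"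
  where "list_prod xs \<equiv> foldr (\<otimes>) xs \<one>"

lemma list_prod_closed: "set xs \<subseteq> carrier G \<Longrightarrow> list_prod xs \<in> carrier G"
  by (induction xs) auto

lemma list_prod_append:
  "set xs \<subseteq> carrier G \<Longrightarrow> set ys \<subseteq> carrier G
    \<Longrightarrow> list_prod (xs @ ys) = list_prod xs \<otimes> list_prod ys"
  by (induction xs) (auto simp: m_assoc list_prod_closed)

lemma ordered_prod_closed: "range b \<subseteq> carrier G \<Longrightarrow> ordered_prod G b m \<in> carrier G"
  by (induction m) auto

text \<open>This prepares the Cauchy estimate: the inverse of the \<open>l\<close>-th partial
  product cancels the first factor and leaves the block. The block starts at \<open>Suc l\<close>
  because \<open>b l\<close> already belongs to the partial product.\<close>

lemma ordered_prod_split: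
  assumes b: "range b \<subseteq> carrier G" and "l \<le> m"
  shows "ordered_prod G b m = ordered_prod G b l \<otimes> list_prod (map b [Suc l..<Suc m])"
  using \<open>l \<le> m\<close>
proof (induction m rule: dec_induct)
  case base
  then show ?case using ordered_prod_closed[OF b] by simp
next
  case (step m)
  have *: "set (map b ns) \<subseteq> carrier G" for ns using b by auto
  have "[Suc l..<Suc (Suc m)] = [Suc l..<Suc m] @ [Suc m]" using step by simp
  then have "list_prod (map b [Suc l..<Suc (Suc m)])
      = list_prod (map b [Suc l..<Suc m]) \<otimes> b (Suc m)"
    using list_prod_append[OF *[of "[Suc l..<Suc m]"] *[of "[Suc m]"]] b
    by (simp del: upt_Suc add: range_subsetD)
  then show ?case
    using step ordered_prod_closed[OF b] list_prod_closed[OF *] b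
    by (simp del: upt_Suc add: m_assoc range_subsetD)
qed

text \<open>A factor is measured by \<open>\<iota> n\<close> and not by its place in the list, so
  rearrangements are covered. The induction leaves \<open>k\<close> arbitrary because both sides of
  the split are treated at level \<open>\<iota> m\<close>; distinctness makes
  \<open>\<iota> m\<close> strictly smaller than every other index.\<close>

lemma list_prod_distinct_index_mem:
  fixes U :: "nat \<Rightarrow> 'a set" and \<iota> :: "'i \<Rightarrow> nat"
  assumes one: "\<And>n. \<one> \<in> U n" and UG: "\<And>n. U n \<subseteq> carrier G"
    and U3: "\<And>n x y z. \<lbrakk>x \<in> U (Suc n); y \<in> U (Suc n); z \<in> U (Suc n)\<rbrakk> \<Longrightarrow> x \<otimes> y \<otimes> z \<in> U n"
    and "distinct (map \<iota> ns)" and "\<And>n. n \<in> set ns \<Longrightarrow> k < \<iota> n \<and> b n \<in> U (\<iota> n)"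
  shows "list_prod (map b ns) \<in> U k"
  using assms(4,5)
proof (induction "length ns" arbitrary: ns k rule: less_induct)
  case less
  have mono: "U n \<subseteq> U k" if "k \<le> n" for k n
  proof -
    have "U (Suc n) \<subseteq> U n" for n
    proof
      fix x assume x: "x \<in> U (Suc n)"
      \<comment> \<open>Padding with \<open>\<one>\<close> turns the condition on triple products
        into an inclusion.\<close>
      then have "x \<otimes> \<one> \<otimes> \<one> \<in> U n" using U3 one by blast
      moreover have "x \<in> carrier G" using x UG by blast
      ultimately show "x \<in> U n" by simp
    qed
    then show ?thesis using that lift_Suc_antimono_le[of U] by blast
  qed
  show ?case
  proof (cases "ns = []")
    case False
    define m where "m = arg_min_on \<iota> (set ns)"
    have m: "m \<in> set ns" and min: "\<And>n. n \<in> set ns \<Longrightarrow> \<iota> m \<le> \<iota> n"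
      using False arg_min_if_finite[of "set ns" \<iota>] unfolding m_def by (auto simp: not_less[symmetric])
    obtain as bs where ns: "ns = as @ m # bs" using m by (meson split_list)
    have bG: "b n \<in> carrier G" if "n \<in> set ns" for n using less.prems(2)[OF that] UG by blast
    have ab: "\<iota> m < \<iota> n" if "n \<in> set as \<union> set bs" for n
    proof -
      have "\<iota> n \<noteq> \<iota> m" using that less.prems(1) by (auto simp: ns rev_image_eqI)
      then show ?thesis using min[of n] that by (auto simp: ns)
    qed
    have "list_prod (map b as) \<in> U (\<iota> m)" "list_prod (map b bs) \<in> U (\<iota> m)"
      using less.prems ab by (auto intro!: less.hyps simp: ns)
    \<comment> \<open>The two sides and \<open>b m\<close> all lie in \<open>U (\<iota> m)\<close>.
      Multiplying the three costs one level, which \<open>k < \<iota> m\<close> leaves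
      available.\<close>
    moreover obtain j where j: "\<iota> m = Suc j" "k \<le> j"
      using less.prems(2)[OF m] by (cases "\<iota> m") auto
    ultimately have "list_prod (map b as) \<otimes> b m \<otimes> list_prod (map b bs) \<in> U k"
      using U3 less.prems(2)[OF m] mono[OF j(2)] by (metis subsetD)
    moreover have "list_prod (map b ns) = list_prod (map b as) \<otimes> b m \<otimes> list_prod (map b bs)"
    proof -
      have "set (map b as) \<subseteq> carrier G" "set (map b bs) \<subseteq> carrier G" "b m \<in> carrier G"
        using bG by (auto simp: ns)
      then show ?thesis using list_prod_append[of "map b as" "map b (m # bs)"]
        by (simp add: ns m_assoc list_prod_closed)
    qed
    ultimately show ?thesis by simp
  qed (use one in simp)
qed

end

section \<open>Neighbourhoods of the identity\<close>

context topological_group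
begin

lemma openin_subset_carrier: "openin T U \<Longrightarrow> U \<subseteq> carrier G"
  using openin_subset topspace_eq by blast

lemma nbhd_mult:
  assumes "openin T U" "\<one> \<in> U"
  obtains V where "openin T V" "\<one> \<in> V" "\<And>x y. x \<in> V \<Longrightarrow> y \<in> V \<Longrightarrow> x \<otimes> y \<in> U"
proof -
  let ?P = "{p \<in> topspace (prod_topology T T). fst p \<otimes> snd p \<in> U}"
  have "openin (prod_topology T T) ?P"
    using openin_continuous_map_preimage[OF continuous_mult assms(1)] .
  moreover have "(\<one>, \<one>) \<in> ?P" using assms topspace_eq by auto
  ultimately obtain A B where AB: "openin T A" "openin T B" "\<one> \<in> A" "\<one> \<in> B" "A \<times> B \<subseteq> ?P"
    unfolding openin_prod_topology_alt by meson
  show thesis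
    by (rule that[of "A \<inter> B"]) (use AB in auto)
qed

lemma nbhd_mult3:
  assumes "openin T U" "\<one> \<in> U"
  obtains V where "openin T V" "\<one> \<in> V"
    "\<And>x y z. x \<in> V \<Longrightarrow> y \<in> V \<Longrightarrow> z \<in> V \<Longrightarrow> x \<otimes> y \<otimes> z \<in> U"
proof -
  obtain V where V: "openin T V" "\<one> \<in> V" "\<And>x y. x \<in> V \<Longrightarrow> y \<in> V \<Longrightarrow> x \<otimes> y \<in> U"
    using nbhd_mult[OF assms] by blast
  obtain W where W: "openin T W" "\<one> \<in> W" "\<And>x y. x \<in> W \<Longrightarrow> y \<in> W \<Longrightarrow> x \<otimes> y \<in> V"
    using nbhd_mult[OF V(1,2)] by blast
  \<comment> \<open>In \<open>(x \<otimes> y) \<otimes> z\<close> membership in \<open>W\<close>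
    puts the first product into \<open>V\<close>, and membership of \<open>z\<close> in
    \<open>V\<close> does the rest.\<close>
  show thesis
    by (rule that[of "V \<inter> W"]) (use V W in auto)
qed

lemma nbhd_inv:
  assumes "openin T U" "\<one> \<in> U"
  obtains V where "openin T V" "\<one> \<in> V" "V \<subseteq> U" "\<And>x. x \<in> V \<Longrightarrow> inv x \<in> U"
proof (rule that[of "U \<inter> {x \<in> topspace T. inv x \<in> U}"])
  show "openin T (U \<inter> {x \<in> topspace T. inv x \<in> U})"
    using openin_continuous_map_preimage[OF continuous_inv assms(1)] assms by blast
qed (use assms topspace_eq in auto)

text \<open>One more factor \<open>x\<close> is absorbed by \<open>nbhd_mult\<close>;
  \<open>U\<close> stays arbitrary since the induction hypothesis is applied to a smaller
  neighbourhood.\<close>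

lemma nbhd_nat_pow:
  assumes "openin T U" "\<one> \<in> U"
  shows "\<exists>V. openin T V \<and> \<one> \<in> V \<and> (\<forall>x\<in>V. \<forall>k\<le>N. x [^] (k::nat) \<in> U)"
  using assms
proof (induction N arbitrary: U)
  case 0
  then show ?case by auto
next
  case (Suc N)
  obtain V where V: "openin T V" "\<one> \<in> V" "\<And>x y. x \<in> V \<Longrightarrow> y \<in> V \<Longrightarrow> x \<otimes> y \<in> U"
    using nbhd_mult[OF Suc.prems] by blast
  obtain W where W: "openin T W" "\<one> \<in> W" "\<And>x k. x \<in> W \<Longrightarrow> k \<le> N \<Longrightarrow> x [^] (k::nat) \<in> V"
    using Suc.IH[OF V(1,2)] by blast
  have "x [^] k \<in> U" if x: "x \<in> V \<inter> W" and k: "k \<le> Suc N" for x and k :: nat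
  proof (cases k)
    case (Suc j)
    then show ?thesis using x k V(3) W(3)[of x j] by simp
  qed (use Suc.prems in simp)
  then show ?case using V W by (intro exI[of _ "V \<inter> W"]) auto
qed

lemma nbhd_int_pow:
  assumes "openin T U" "\<one> \<in> U"
  obtains V where "openin T V" "\<one> \<in> V" "\<And>x z. x \<in> V \<Longrightarrow> \<bar>z\<bar> \<le> int N \<Longrightarrow> x [^] z \<in> U"
proof -
  \<comment> \<open>The inclusion \<open>W \<subseteq> U\<close> serves the nonnegative exponents,
    the inverses serve the negative ones.\<close>
  obtain W where W: "openin T W" "\<one> \<in> W" "W \<subseteq> U" "\<And>x. x \<in> W \<Longrightarrow> inv x \<in> U"
    using nbhd_inv[OF assms] by blast
  obtain V where V: "openin T V" "\<one> \<in> V" "\<And>x k. x \<in> V \<Longrightarrow> k \<le> N \<Longrightarrow> x [^] (k::nat) \<in> W"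
    using nbhd_nat_pow[OF W(1,2), of N] by blast
  have "x [^] z \<in> U" if x: "x \<in> V" and z: "\<bar>z\<bar> \<le> int N" for x and z :: int
  proof -
    have "nat \<bar>z\<bar> \<le> N" using z by linarith
    then have W': "x [^] nat \<bar>z\<bar> \<in> W" by (rule V(3)[OF x])
    show ?thesis
    proof (cases "z < 0")
      case True
      then have "x [^] z = inv (x [^] nat \<bar>z\<bar>)" by (simp only: int_pow_def2 if_True abs_of_neg)
      then show ?thesis using W(4)[OF W'] by (simp only:)
    next
      case False
      then have "0 \<le> z" by (rule leI)
      then have "x [^] z = x [^] nat \<bar>z\<bar>" by (simp only: int_pow_def2 False if_False abs_of_nonneg)
      then show ?thesis using W(3) W' by (simp only: subset_iff)
    qed
  qed
  then show thesis using that V by blast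
qed

text \<open>A finite neighbourhood would isolate the identity by the Hausdorff property, and left
  translations would then isolate every point.\<close>

lemma infinite_nbhd_one:
  assumes "T \<noteq> discrete_topology (carrier G)" "openin T U" "\<one> \<in> U"
  shows "infinite U"
proof
  assume "finite U"
  have "closedin T (U - {\<one>})"
    using Hausdorff \<open>finite U\<close> openin_subset[OF assms(2)]
    by (intro closedin_Hausdorff_finite) auto
  then have "openin T (U - (U - {\<one>}))" using assms(2) by blast
  moreover have "U - (U - {\<one>}) = {\<one>}" using assms(3) by auto
  ultimately have one: "openin T {\<one>}" by simp
  have "openin T {g}" if g: "g \<in> carrier G" for g
  proof -
    \<comment> \<open>Left translation by \<open>inv g\<close> is continuous and pulls
      \<open>{\<one>}\<close> back to \<open>{g}\<close>.\<close>
    have "continuous_map T (prod_topology T T) (\<lambda>x. (inv g, x))"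
      using g topspace_eq by (simp add: continuous_map_pairedI)
    then have "continuous_map T T (\<lambda>x. inv g \<otimes> x)"
      using continuous_map_compose[OF _ continuous_mult] by (fastforce simp: o_def)
    then have "openin T {x \<in> topspace T. inv g \<otimes> x \<in> {\<one>}}"
      using one by (rule openin_continuous_map_preimage)
    moreover have "{x \<in> topspace T. inv g \<otimes> x \<in> {\<one>}} = {g}"
    proof -
      have "inv g \<otimes> x = \<one> \<longleftrightarrow> x = g" if "x \<in> carrier G" for x
        using inv_solve_left'[of \<one> g x] g that by auto
      then show ?thesis using g topspace_eq by auto
    qed
    ultimately show ?thesis by simp
  qed
  then have "T = discrete_topology (carrier G)"
    using topspace_eq by (intro discrete_topology_unique[THEN iffD2, symmetric]) auto
  with assms(1) show False by simp
qed

text \<open>Metrizability enters through first countability. A countable base at the identity is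
  enumerated as \<open>B n\<close>; each next set is chosen small enough for triple products and is
  also cut down to \<open>B (Suc n)\<close>, so the result is again a base.\<close>

lemma countable_cubic_base:
  assumes "metrizable_space T"
  obtains U :: "nat \<Rightarrow> 'a set"
  where "\<And>n. openin T (U n)" "\<And>n. \<one> \<in> U n"
    "\<And>n x y z. \<lbrakk>x \<in> U (Suc n); y \<in> U (Suc n); z \<in> U (Suc n)\<rbrakk> \<Longrightarrow> x \<otimes> y \<otimes> z \<in> U n"
    "\<And>V. openin T V \<Longrightarrow> \<one> \<in> V \<Longrightarrow> \<exists>n. U n \<subseteq> V"
proof -
  have "first_countable T" using assms by (rule metrizable_imp_first_countable)
  then obtain \<B> where \<B>: "countable \<B>" "\<And>V. V \<in> \<B> \<Longrightarrow> openin T V"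
      "\<And>V. openin T V \<Longrightarrow> \<one> \<in> V \<Longrightarrow> \<exists>B\<in>\<B>. \<one> \<in> B \<and> B \<subseteq> V"
    unfolding first_countable_def using topspace_eq one_closed by metis
  define \<C> where "\<C> = {B \<in> \<B>. \<one> \<in> B}"
  \<comment> \<open>The enumeration may repeat sets, so a finite \<open>\<C>\<close> is no obstacle
    once it is nonempty.\<close>
  define B where "B = from_nat_into \<C>"
  have "\<one> \<in> topspace T" using topspace_eq by simp
  then have "\<C> \<noteq> {}" using \<B>(3)[OF openin_topspace] unfolding \<C>_def by blast
  moreover have "countable \<C>" using \<B>(1) by (simp add: \<C>_def)
  ultimately have range: "range B = \<C>" unfolding B_def by (rule range_from_nat_into)
  then have B: "openin T (B n)" "\<one> \<in> B n" for n using \<B>(2) unfolding \<C>_def by blast+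
  have "\<exists>U. \<forall>n. (openin T (U n) \<and> \<one> \<in> U n \<and> U n \<subseteq> B n) \<and>
      (\<forall>x\<in>U (Suc n). \<forall>y\<in>U (Suc n). \<forall>z\<in>U (Suc n). x \<otimes> y \<otimes> z \<in> U n)"
  proof (rule dependent_nat_choice)
    show "\<exists>V. openin T V \<and> \<one> \<in> V \<and> V \<subseteq> B 0" using B by blast
    fix V n assume "openin T V \<and> \<one> \<in> V \<and> V \<subseteq> B n"
    then obtain W where "openin T W" "\<one> \<in> W"
      "\<And>x y z. x \<in> W \<Longrightarrow> y \<in> W \<Longrightarrow> z \<in> W \<Longrightarrow> x \<otimes> y \<otimes> z \<in> V"
      using nbhd_mult3 by metis
    then show "\<exists>W. (openin T W \<and> \<one> \<in> W \<and> W \<subseteq> B (Suc n)) \<and>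
        (\<forall>x\<in>W. \<forall>y\<in>W. \<forall>z\<in>W. x \<otimes> y \<otimes> z \<in> V)"
      using B by (intro exI[of _ "W \<inter> B (Suc n)"]) auto
  qed
  then obtain U where *: "\<forall>n. (openin T (U n) \<and> \<one> \<in> U n \<and> U n \<subseteq> B n) \<and>
      (\<forall>x\<in>U (Suc n). \<forall>y\<in>U (Suc n). \<forall>z\<in>U (Suc n). x \<otimes> y \<otimes> z \<in> U n)"
    by (rule exE)
  have U: "openin T (U n)" "\<one> \<in> U n" "U n \<subseteq> B n" for n
    using *[rule_format, of n] by simp_all
  have U3: "x \<otimes> y \<otimes> z \<in> U n" if "x \<in> U (Suc n)" "y \<in> U (Suc n)" "z \<in> U (Suc n)" for n x y z
    using * that by simp
  have "\<exists>n. U n \<subseteq> V" if V: "openin T V" "\<one> \<in> V" for V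
  proof -
    obtain C where "C \<in> \<C>" "C \<subseteq> V" using \<B>(3)[OF V] unfolding \<C>_def by auto
    moreover from this obtain n where "C = B n" using range by blast
    ultimately show ?thesis using U(3)[of n] by blast
  qed
  with U(1,2) U3 show thesis by (rule that)
qed

section \<open>From completeness to productive sequences\<close>

text \<open>The Cauchy condition is asked only for \<open>l \<le> m\<close>, the case in which a
  block of factors remains; the other order follows by inversion. \<open>weil_complete_net\<close>
  admits \<open>nat\<close> as index type.\<close>

lemma left_cauchy_sequence_convergent:
  assumes complete: "weil_complete G T" and x: "range x \<subseteq> carrier G"
    and cauchy: "\<And>U. openin T U \<Longrightarrow> \<one> \<in> U
      \<Longrightarrow> \<exists>k. \<forall>l m. k \<le> l \<longrightarrow> l \<le> m \<longrightarrow> inv (x l) \<otimes> x m \<in> U"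
  shows "\<exists>l\<in>carrier G. limitin T x l sequentially"
proof -
  let ?r = "{(m, n). m \<le> n} :: nat rel"
  have "directed_set UNIV ?r"
    unfolding directed_set_def preorder_on_def
    by (auto simp: refl_on_def trans_def intro: max.cobounded1 max.cobounded2)
  moreover have "left_cauchy_net G T UNIV ?r x"
    unfolding left_cauchy_net_def
  proof (intro conjI allI impI)
    fix U assume "openin T U \<and> \<one> \<in> U"
    then obtain V where V: "openin T V" "\<one> \<in> V" "V \<subseteq> U" "\<And>x. x \<in> V \<Longrightarrow> inv x \<in> U"
      using nbhd_inv by blast
    obtain k where k: "\<And>l m. k \<le> l \<Longrightarrow> l \<le> m \<Longrightarrow> inv (x l) \<otimes> x m \<in> V"
      using cauchy[OF V(1,2)] by blast
    have "inv (x i) \<otimes> x j \<in> U" if "k \<le> i" "k \<le> j" for i j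
    proof (cases "i \<le> j")
      case True
      then show ?thesis using k that V by blast
    next
      case False
      then have "inv (inv (x j) \<otimes> x i) \<in> U" using k that V by simp
      then show ?thesis using x by (simp add: inv_mult_group range_subsetD)
    qed
    then show "\<exists>k\<in>UNIV. \<forall>i\<in>UNIV. \<forall>j\<in>UNIV.
        (k, i) \<in> ?r \<and> (k, j) \<in> ?r \<longrightarrow> inv (x i) \<otimes> x j \<in> U" by auto
  qed (use x in auto)
  ultimately obtain l where "net_converges_to T UNIV ?r x l"
    using weil_complete_net[OF topological_group_axioms complete] by blast
  then have "l \<in> carrier G" "limitin T x l sequentially"
    using topspace_eq by (auto simp: net_converges_to_def limitin_sequentially)
  then show ?thesis by blast
qed

text \<open>Quotients of partial products are blocks of late factors. Injectivity of
  \<open>\<iota>\<close> forces late factors to have large indices, so these blocks are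
  small.\<close>

lemma productive_if_distinct_index:
  fixes U :: "nat \<Rightarrow> 'a set" and \<iota> :: "nat \<Rightarrow> nat"
  assumes complete: "weil_complete G T"
    and U: "\<And>n. openin T (U n)" "\<And>n. \<one> \<in> U n"
      "\<And>n x y z. \<lbrakk>x \<in> U (Suc n); y \<in> U (Suc n); z \<in> U (Suc n)\<rbrakk> \<Longrightarrow> x \<otimes> y \<otimes> z \<in> U n"
      "\<And>V. openin T V \<Longrightarrow> \<one> \<in> V \<Longrightarrow> \<exists>n. U n \<subseteq> V"
    and \<iota>: "inj \<iota>" and b: "\<And>n. b n \<in> U (\<iota> n)"
  shows "productive G T b"
proof -
  have UG: "U n \<subseteq> carrier G" for n using U(1) openin_subset_carrier by blast
  have bG: "range b \<subseteq> carrier G" using b UG by blast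
  have "\<exists>k. \<forall>l m. k \<le> l \<longrightarrow> l \<le> m \<longrightarrow> inv (ordered_prod G b l) \<otimes> ordered_prod G b m \<in> V"
    if V: "openin T V" "\<one> \<in> V" for V
  proof -
    obtain k where k: "U k \<subseteq> V" using U(4)[OF V] by blast
    \<comment> \<open>Only finitely many positions carry an index at most \<open>k\<close>. Beyond
      the last of them, bounded by \<open>N\<close>, every index exceeds \<open>k\<close>; blocks
      starting at \<open>Suc l\<close> with \<open>N \<le> l\<close> avoid them all.\<close>
    have "finite (\<iota> -` {..k})" using \<iota> by (intro finite_vimageI) auto
    then obtain N where "\<forall>n\<in>\<iota> -` {..k}. n \<le> N" by (meson finite_nat_set_iff_bounded_le)
    then have N: "k < \<iota> n" if "N < n" for n using that by (auto simp: not_less[symmetric])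
    have "inv (ordered_prod G b l) \<otimes> ordered_prod G b m \<in> V" if "N \<le> l" "l \<le> m" for l m
    proof -
      let ?ns = "[Suc l..<Suc m]"
      have "list_prod (map b ?ns) \<in> U k"
      proof (rule list_prod_distinct_index_mem[of U \<iota>])
        show "distinct (map \<iota> ?ns)"
          unfolding distinct_map using distinct_upt inj_on_subset[OF \<iota> subset_UNIV] by blast
      qed (use U UG N b that in auto)
      moreover have "set (map b ?ns) \<subseteq> carrier G" using bG by auto
      then have "inv (ordered_prod G b l) \<otimes> ordered_prod G b m = list_prod (map b ?ns)"
        using ordered_prod_closed[OF bG] list_prod_closed
        by (simp del: upt_Suc add: ordered_prod_split[OF bG that(2)] m_assoc[symmetric])
      ultimately show ?thesis using k by auto
    qed
    then show ?thesis by blast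
  qed
  then have "\<exists>l\<in>carrier G. limitin T (ordered_prod G b) l sequentially"
    using ordered_prod_closed[OF bG] by (intro left_cauchy_sequence_convergent[OF complete]) auto
  then show ?thesis using bG unfolding productive_def by simp
qed

end

section \<open>Construction of the sequence and its rearrangements\<close>

theorem corollary5p4:
  fixes G :: "('a, 'b) monoid_scheme" and T :: "'a topology" and f :: "nat \<Rightarrow> nat"
  assumes "topological_group G T"
    and "metrizable_space T"
    and "T \<noteq> discrete_topology (carrier G)"
    and "weil_complete G T"
    and "\<And>n. f n \<noteq> 0"
  shows "\<exists>a :: nat \<Rightarrow> 'a. unconditionally_f_productive G T f a"
proof -
  interpret topological_group G T by fact
  obtain U :: "nat \<Rightarrow> 'a set" where U: "\<And>n. openin T (U n)" "\<And>n. \<one>\<^bsub>G\<^esub> \<in> U n"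
    "\<And>n x y z. \<lbrakk>x \<in> U (Suc n); y \<in> U (Suc n); z \<in> U (Suc n)\<rbrakk> \<Longrightarrow> x \<otimes>\<^bsub>G\<^esub> y \<otimes>\<^bsub>G\<^esub> z \<in> U n"
    "\<And>V. openin T V \<Longrightarrow> \<one>\<^bsub>G\<^esub> \<in> V \<Longrightarrow> \<exists>n. U n \<subseteq> V"
    using countable_cubic_base[OF assms(2)] by blast
  \<comment> \<open>Membership in \<open>W n\<close> controls all exponents allowed by
    \<open>f n\<close> at once, so \<open>a\<close> can be chosen before \<open>z\<close> and
    \<open>\<phi>\<close> are given.\<close>
  have "\<exists>V. openin T V \<and> \<one>\<^bsub>G\<^esub> \<in> V \<and> (\<forall>x\<in>V. \<forall>z. \<bar>z\<bar> \<le> int (f n) \<longrightarrow> x [^]\<^bsub>G\<^esub> z \<in> U n)" for n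
    using nbhd_int_pow[OF U(1,2)] by metis
  then obtain W where W: "\<And>n. openin T (W n)" "\<And>n. \<one>\<^bsub>G\<^esub> \<in> W n"
    "\<And>n x z. x \<in> W n \<Longrightarrow> \<bar>z\<bar> \<le> int (f n) \<Longrightarrow> x [^]\<^bsub>G\<^esub> z \<in> U n"
    by metis
  have "infinite (W n)" for n using infinite_nbhd_one[OF assms(3)] W by blast
  then obtain a where a: "inj a" "\<And>n. a n \<in> W n" using inj_choice_infinite by blast
  have aG: "range a \<subseteq> carrier G" using a W openin_subset_carrier by blast
  have "f_productive G T (f \<circ> \<phi>) (\<lambda>n. a (\<phi> n))" if "bij \<phi>" for \<phi>
    unfolding f_productive_def
  proof (intro conjI allI impI)
    have \<phi>: "inj \<phi>" using that by (rule bij_is_inj)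
    show "inj (\<lambda>n. a (\<phi> n))" using inj_compose[OF a(1) \<phi>] by (simp add: o_def)
    fix z :: "nat \<Rightarrow> int" assume "\<forall>n. \<bar>z n\<bar> \<le> int ((f \<circ> \<phi>) n)"
    then show "productive G T (\<lambda>n. a (\<phi> n) [^]\<^bsub>G\<^esub> z n)"
      \<comment> \<open>The index function is \<open>\<phi>\<close> itself: the bound
        \<open>f (\<phi> n)\<close> belongs to \<open>a (\<phi> n)\<close> and puts the
        \<open>n\<close>-th factor into \<open>U (\<phi> n)\<close>.\<close>
      using a W by (intro productive_if_distinct_index[OF assms(4) U \<phi>]) auto
  qed (use aG in auto)
  then show ?thesis unfolding unconditionally_f_productive_def using a aG by blast
qed

end
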